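(* There exists a matrix $\mathbf{G}\in\mathbb{R}^{5\times5}$ such that $$\bigl\langle \mathbf{G},\operatorname{polar}(\operatorname{sign}(\mathbf{G}))\bigr\rangle\approx-13.89<0$$ (the value rounds to $-13.89$ at two decimals). Consequently MuonUSign ascends on the linear objective $f(\mathbf{X})=\langle\mathbf{G},\mathbf{X}\rangle=\operatorname{Tr}(\mathbf{G}^\top\mathbf{X})$ on $\mathbb{R}^{5\times5}$: for every starting point $\mathbf{X}_0$, every sequence of step sizes $\eta_t>0$, every momentum coefficient $\mu\in[0,1)$ and both momentum variants (standard and Nesterov), $f(\mathbf{X}_t)>f(\mathbf{X}_{t-1})$ for every $t\ge1$.
   Context: $\langle\mathbf{A},\mathbf{B}\rangle=\sum_{i,j}A_{ij}B_{ij}$. For a matrix $\mathbf{M}$ of rank $r$ with thin singular value decomposition $\mathbf{M}=\mathbf{U}\boldsymbol{\Sigma}\mathbf{V}^\top$ ($\mathbf{U},\mathbf{V}$ with $r$ orthonormal columns, one per nonzero singular value), $\operatorname{polar}(\mathbf{M}):=\mathbf{U}\mathbf{V}^\top$. The function $\operatorname{sign}(\cdot)$ acts entrywise with values in $\{\pm1\}$; an exact zero is resolved to an arbitrary (random) $\pm1$, and assertions about signs are to hold for every such resolution. MuonUSign with exact gradients: $\mathbf{M}_0=\mathbf{0}$ and, for $t\ge1$, $\mathbf{G}_t=\nabla f(\mathbf{X}_{t-1})$, $\mathbf{M}_t=\mu\mathbf{M}_{t-1}+(1-\mu)\mathbf{G}_t$; $\tilde{\mathbf{M}}_t=\mathbf{M}_t$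 (standard) or $\tilde{\mathbf{M}}_t=(1-\mu)\mathbf{G}_t+\mu\mathbf{M}_t$ (Nesterov); $\mathbf{s}_t=\operatorname{polar}(\operatorname{sign}(\tilde{\mathbf{M}}_t))$; $\mathbf{X}_t=\mathbf{X}_{t-1}-\eta_t\mathbf{s}_t$. *)

theory Defs
  imports "HOL-Analysis.Analysis"
begin

text \<open>
  The Frobenius inner product of two matrices is the library's inner product \<^term>\<open>(\<bullet>)\<close> on
  \<^typ>\<open>real^'n^'m\<close>; gradients (\<^const>\<open>gderiv\<close>) are taken with respect to it.
\<close>

text \<open>
  The columns of the factors of a thin SVD are the vectors \<open>u k\<close>, \<open>v k\<close> with \<open>k < rank M\<close>; the
  number of columns depends on \<open>M\<close>, so they are indexed by natural numbers. Values at
  indices \<open>k \<ge> rank M\<close> are irrelevant. The singular values are not required to be sorted.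
\<close>

definition thin_svd ::
  "real^'n^'m \<Rightarrow> (nat \<Rightarrow> real) \<Rightarrow> (nat \<Rightarrow> real^'m) \<Rightarrow> (nat \<Rightarrow> real^'n) \<Rightarrow> bool" where
  "thin_svd M \<sigma> u v \<longleftrightarrow>
     (\<forall>k<rank M. \<sigma> k > 0) \<and>
     (\<forall>k<rank M. \<forall>l<rank M. u k \<bullet> u l = (if k = l then 1 else 0)) \<and>
     (\<forall>k<rank M. \<forall>l<rank M. v k \<bullet> v l = (if k = l then 1 else 0)) \<and>
     M = (\<chi> i j. \<Sum>k<rank M. u k $ i * \<sigma> k * v k $ j)"

text \<open>
  Every real matrix has a thin SVD, and the product \<open>U V\<^sup>T\<close> does not depend on its choice, so the
  description below determines the matrix uniquely.
\<close>

definition polar :: "real^'n^'m \<Rightarrow> real^'n^'m" where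
  "polar M = (THE P. \<exists>\<sigma> u v. thin_svd M \<sigma> u v \<and>
                P = (\<chi> i j. \<Sum>k<rank M. u k $ i * v k $ j))"

text \<open>
  Each zero entry of \<open>M\<close> may be resolved to either sign, independently of the others, so
  entrywise signs form a relation.
\<close>

definition is_sign_of :: "real^'n^'m \<Rightarrow> real^'n^'m \<Rightarrow> bool" where
  "is_sign_of M S \<longleftrightarrow>
     (\<forall>i j. S $ i $ j \<in> {-1, 1} \<and> (M $ i $ j \<noteq> 0 \<longrightarrow> S $ i $ j = sgn (M $ i $ j)))"

datatype momentum = Standard | Nesterov

fun update_momentum ::
  "momentum \<Rightarrow> real \<Rightarrow> real^'n^'m \<Rightarrow> real^'n^'m \<Rightarrow> real^'n^'m" where
  "update_momentum Standard \<mu> G M = M"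
| "update_momentum Nesterov \<mu> G M = (1 - \<mu>) *\<^sub>R G + \<mu> *\<^sub>R M"

text \<open>
  \<open>X\<close> is a possible sequence of iterates of MuonUSign with exact gradients. It is not unique
  because zero signs may be resolved differently, and afresh in each step.
\<close>

definition MuonUSign_run ::
  "momentum \<Rightarrow> (real^'n^'m \<Rightarrow> real) \<Rightarrow> real \<Rightarrow> (nat \<Rightarrow> real) \<Rightarrow> real^'n^'m \<Rightarrow>
   (nat \<Rightarrow> real^'n^'m) \<Rightarrow> bool" where
  "MuonUSign_run variant f \<mu> \<eta> X\<^sub>0 X \<longleftrightarrow>
     X 0 = X\<^sub>0 \<and>
     (\<exists>G M S. M 0 = 0 \<and>
       (\<forall>t\<ge>1.
          (GDERIV f (X (t - 1)) :> G t) \<and>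
          M t = \<mu> *\<^sub>R M (t - 1) + (1 - \<mu>) *\<^sub>R G t \<and>
          is_sign_of (update_momentum variant \<mu> (G t) (M t)) (S t) \<and>
          X t = X (t - 1) - \<eta> t *\<^sub>R polar (S t)))"

end

theory Submission
  imports Defs
begin

text \<open>
  The polar factor of an invertible matrix can disagree in sign with the matrix itself at some
  entry, and a gradient concentrated at such an entry is ascended rather than descended. Let \<open>S\<close>
  be the \<open>5 \<times> 5\<close> sign matrix with \<open>-1\<close> on the diagonal except for its top left corner, and \<open>+1\<close>
  elsewhere. It is symmetric and invertible, so its polar factor keeps the eigenvectors and
  replaces each eigenvalue by its sign. On the vectors \<open>(0, y)\<close> with \<open>y\<close> of sum zero, \<open>S\<close> is
  multiplication by \<open>-2\<close>. On the plane spanned by the first unit vector and \<open>(0, 1, 1, 1, 1) / 2\<close>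
  it acts as the matrix with rows \<open>(1, 2)\<close> and \<open>(2, 2)\<close>, with eigenvalues \<open>(3 \<plusminus> \<surd>17) / 2\<close> of
  opposite signs. Its sign is therefore obtained by subtracting \<open>3 / 2\<close> on the diagonal and
  dividing by \<open>\<surd>17 / 2\<close>, which turns the corner entry \<open>1\<close> into \<open>-1 / \<surd>17\<close>.

  The gradient \<open>G\<close> agrees with \<open>S\<close> except that its corner is \<open>100\<close>. The corner contributes
  \<open>-100 / \<surd>17\<close> to the inner product with the polar factor and the other entries contribute
  \<open>6 + 18 / \<surd>17\<close>, so that the total is \<open>6 - 82 / \<surd>17\<close>
  (\<open>inner_corner_gradient_polar\<close>).

  The polar factor is defined as a unique description over all thin singular value
  decompositions, so its computation needs independence of the decomposition
  (\<open>thin_svd_polar_unique\<close>); \<open>polar_eqI\<close> then reduces the computation to the action on an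
  orthogonal basis of eigenvectors.

  For a linear objective the gradient is constant, so each momentum buffer is a positive multiple
  of \<open>G\<close> (\<open>MuonUSign_run_linear_step\<close>). As \<open>G\<close> has no zero entries, every step uses the same
  sign matrix \<open>S\<close> and changes the objective by \<open>-\<eta> t\<close> times the negative number above.
\<close>

section \<open>The polar factor from a thin singular value decomposition\<close>

lemma sum_outer_product_mult_vec:
  fixes u :: "nat \<Rightarrow> real^'m" and v :: "nat \<Rightarrow> real^'n"
  shows "(\<chi> i j. \<Sum>k<r. u k $ i * c k * v k $ j) *v x = (\<Sum>k<r. (c k * (v k \<bullet> x)) *\<^sub>R u k)"
  by (simp add: vec_eq_iff matrix_vector_mult_def inner_vec_def sum_distrib_left sum_distrib_right
      sum.swap[of _ "{..<r}"] mult_ac)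

lemma transpose_sum_outer_product:
  "transpose (\<chi> i j. \<Sum>k<(r::nat). u k $ i * (c k :: real) * v k $ j)
     = (\<chi> i j. \<Sum>k<r. v k $ i * c k * u k $ j)"
  by (simp add: transpose_def vec_eq_iff mult_ac)

lemma thin_svd_mult_vec:
  assumes "thin_svd M \<sigma> u v" and "l < rank M"
  shows "M *v v l = \<sigma> l *\<^sub>R u l" and "transpose M *v u l = \<sigma> l *\<^sub>R v l"
    and "M *v x = (\<Sum>k<rank M. (\<sigma> k * (v k \<bullet> x)) *\<^sub>R u k)"
    and "transpose M *v y = (\<Sum>k<rank M. (\<sigma> k * (u k \<bullet> y)) *\<^sub>R v k)"
proof -
  let ?N = "\<chi> i j. \<Sum>k<rank M. u k $ i * \<sigma> k * v k $ j"
  have M: "M = ?N"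
    and u: "\<And>k. k < rank M \<Longrightarrow> u k \<bullet> u l = (if k = l then 1 else 0)"
    and v: "\<And>k. k < rank M \<Longrightarrow> v k \<bullet> v l = (if k = l then 1 else 0)"
    using assms unfolding thin_svd_def by blast+
  show Mx: "M *v x = (\<Sum>k<rank M. (\<sigma> k * (v k \<bullet> x)) *\<^sub>R u k)" for x
    using arg_cong[OF M, of "\<lambda>A. A *v x"] by (simp add: sum_outer_product_mult_vec)
  show My: "transpose M *v y = (\<Sum>k<rank M. (\<sigma> k * (u k \<bullet> y)) *\<^sub>R v k)" for y
    using arg_cong[OF M, of "\<lambda>A. transpose A *v y"]
    by (simp add: transpose_sum_outer_product sum_outer_product_mult_vec)
  have "(\<Sum>k<rank M. (\<sigma> k * (v k \<bullet> v l)) *\<^sub>R u k) = (\<Sum>k<rank M. if k = l then \<sigma> l *\<^sub>R u l else 0)"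
    by (rule sum.cong) (auto simp: v)
  then show "M *v v l = \<sigma> l *\<^sub>R u l"
    using assms(2) by (simp add: Mx)
  have "(\<Sum>k<rank M. (\<sigma> k * (u k \<bullet> u l)) *\<^sub>R v k) = (\<Sum>k<rank M. if k = l then \<sigma> l *\<^sub>R v l else 0)"
    by (rule sum.cong) (auto simp: u)
  then show "transpose M *v u l = \<sigma> l *\<^sub>R v l"
    using assms(2) by (simp add: My del: transpose_matrix_vector)
qed

text \<open>
  Two decompositions of the same matrix may pick different bases inside the singular spaces, yet
  the change of basis is the same on both sides. With \<open>a = v k \<bullet> v' l\<close> and \<open>b = u k \<bullet> u' l\<close>,
  evaluating \<open>u k \<bullet> M v' l\<close> and \<open>v k \<bullet> M\<^sup>T u' l\<close> through either decomposition gives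
  \<open>\<sigma> k a = \<tau> l b\<close> and \<open>\<sigma> k b = \<tau> l a\<close>, hence \<open>(\<sigma> k + \<tau> l) (b - a) = 0\<close>.
\<close>

lemma thin_svd_cross_inner_eq:
  assumes "thin_svd M \<sigma> u v" and "thin_svd M \<tau> u' v'" and k: "k < rank M" and l: "l < rank M"
  shows "u k \<bullet> u' l = v k \<bullet> v' l" and "\<sigma> k * (v k \<bullet> v' l) = \<tau> l * (v k \<bullet> v' l)"
proof -
  have pos: "\<sigma> k > 0" "\<tau> l > 0"
    using assms unfolding thin_svd_def by blast+
  note d = thin_svd_mult_vec[OF assms(1) k] and d' = thin_svd_mult_vec[OF assms(2) l]
  have adj: "(transpose M *v y) \<bullet> x = y \<bullet> (M *v x)" for x y
    by (metis dot_lmul_matrix vector_transpose_matrix transpose_transpose)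
  have 1: "\<sigma> k * (v k \<bullet> v' l) = \<tau> l * (u k \<bullet> u' l)"
    using adj[of "u k" "v' l"] unfolding d(2) d'(1) by simp
  have 2: "\<tau> l * (v k \<bullet> v' l) = \<sigma> k * (u k \<bullet> u' l)"
    using adj[of "u' l" "v k"] unfolding d(1) d'(2) by (simp add: inner_commute)
  have "(\<sigma> k + \<tau> l) * (u k \<bullet> u' l - v k \<bullet> v' l) = 0"
    using 1 2 by (simp add: algebra_simps)
  with pos show eq: "u k \<bullet> u' l = v k \<bullet> v' l"
    by (auto simp: add_pos_pos less_imp_neq)
  show "\<sigma> k * (v k \<bullet> v' l) = \<tau> l * (v k \<bullet> v' l)"
    using 1 eq by simp
qed

text \<open>
  With \<open>C k l = v k \<bullet> v' l\<close>, the cross inner products express each \<open>u' l\<close> through the \<open>u k\<close> by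
  the column \<open>C _ l\<close> and each \<open>v k\<close> through the \<open>v' l\<close> by the row \<open>C k _\<close>. Both products of
  factors therefore equal \<open>U C V'\<^sup>T\<close>.
\<close>

lemma thin_svd_polar_unique:
  assumes D: "thin_svd M \<sigma> u v" and D': "thin_svd M \<tau> u' v'"
  shows "(\<chi> i j. \<Sum>k<rank M. u k $ i * v k $ j) = (\<chi> i j. \<Sum>k<rank M. u' k $ i * v' k $ j)"
    (is "?P = ?P'")
proof -
  let ?r = "rank M"
  have pos: "\<And>k. k < ?r \<Longrightarrow> \<sigma> k > 0" "\<And>k. k < ?r \<Longrightarrow> \<tau> k > 0"
    using assms unfolding thin_svd_def by blast+
  have u': "u' l = (\<Sum>k<?r. (v k \<bullet> v' l) *\<^sub>R u k)" if l: "l < ?r" for l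
  proof -
    have "\<tau> l *\<^sub>R u' l = (\<Sum>k<?r. (\<sigma> k * (v k \<bullet> v' l)) *\<^sub>R u k)"
      using thin_svd_mult_vec(1)[OF D' l] thin_svd_mult_vec(3)[OF D l] by simp
    also have "\<dots> = \<tau> l *\<^sub>R (\<Sum>k<?r. (v k \<bullet> v' l) *\<^sub>R u k)"
      by (simp add: scaleR_sum_right thin_svd_cross_inner_eq(2)[OF D D' _ l])
    finally show ?thesis
      using pos(2)[OF l] by simp
  qed
  have v: "v k = (\<Sum>l<?r. (v k \<bullet> v' l) *\<^sub>R v' l)" if k: "k < ?r" for k
  proof -
    have "\<sigma> k *\<^sub>R v k = (\<Sum>l<?r. (\<tau> l * (u' l \<bullet> u k)) *\<^sub>R v' l)"
      using thin_svd_mult_vec(2)[OF D k] thin_svd_mult_vec(4)[OF D' k] by simp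
    also have "\<dots> = (\<Sum>l<?r. (\<sigma> k * (v k \<bullet> v' l)) *\<^sub>R v' l)"
    proof (rule sum.cong[OF refl])
      fix l assume "l \<in> {..<?r}"
      then have "u' l \<bullet> u k = v k \<bullet> v' l" "\<tau> l * (v k \<bullet> v' l) = \<sigma> k * (v k \<bullet> v' l)"
        using thin_svd_cross_inner_eq[OF D D' k, of l] by (auto simp: inner_commute)
      then show "(\<tau> l * (u' l \<bullet> u k)) *\<^sub>R v' l = (\<sigma> k * (v k \<bullet> v' l)) *\<^sub>R v' l"
        by simp
    qed
    also have "\<dots> = \<sigma> k *\<^sub>R (\<Sum>l<?r. (v k \<bullet> v' l) *\<^sub>R v' l)"
      by (simp add: scaleR_sum_right)
    finally show ?thesis
      using pos(1)[OF k] by simp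
  qed
  have "?P *v x = ?P' *v x" for x
  proof -
    have "?P' *v x = (\<Sum>l<?r. (v' l \<bullet> x) *\<^sub>R u' l)"
      using sum_outer_product_mult_vec[where u = u' and v = v' and c = "\<lambda>_. 1"] by simp
    also have "\<dots> = (\<Sum>l<?r. \<Sum>k<?r. ((v' l \<bullet> x) * (v k \<bullet> v' l)) *\<^sub>R u k)"
      by (rule sum.cong[OF refl]) (subst u', auto simp: scaleR_sum_right)
    also have "\<dots> = (\<Sum>k<?r. ((\<Sum>l<?r. (v k \<bullet> v' l) *\<^sub>R v' l) \<bullet> x) *\<^sub>R u k)"
      by (subst sum.swap) (simp add: inner_sum_left scaleR_sum_left mult.commute)
    also have "\<dots> = (\<Sum>k<?r. (v k \<bullet> x) *\<^sub>R u k)"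
      by (rule sum.cong[OF refl]) (simp flip: v)
    also have "\<dots> = ?P *v x"
      using sum_outer_product_mult_vec[where u = u and v = v and c = "\<lambda>_. 1"] by simp
    finally show ?thesis ..
  qed
  then show ?thesis
    by (simp add: matrix_eq)
qed

lemma polar_thin_svd:
  assumes "thin_svd M \<sigma> u v"
  shows "polar M = (\<chi> i j. \<Sum>k<rank M. u k $ i * v k $ j)"
  unfolding polar_def using assms thin_svd_polar_unique by (intro the_equality) blast+

lemma orthonormal_family_expand:
  fixes v :: "nat \<Rightarrow> real^'n"
  assumes v: "\<And>k l. k < CARD('n) \<Longrightarrow> l < CARD('n) \<Longrightarrow> v k \<bullet> v l = (if k = l then 1 else 0)"
  shows "x = (\<Sum>k<CARD('n). (v k \<bullet> x) *\<^sub>R v k)"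
proof -
  let ?B = "v ` {..<CARD('n)}"
  have inj: "inj_on v {..<CARD('n)}"
    by (rule inj_onI) (metis v lessThan_iff zero_neq_one)
  have norm: "norm b = 1" if "b \<in> ?B" for b
    using that v by (auto simp: norm_eq_1)
  have orth: "pairwise orthogonal ?B"
    using v by (auto simp: pairwise_def orthogonal_def)
  have "independent ?B"
    using norm by (intro pairwise_orthogonal_independent[OF orth]) force
  then have "UNIV \<subseteq> span ?B"
    by (intro card_ge_dim_independent) (auto simp: card_image[OF inj])
  then have "(\<Sum>b\<in>?B. (x \<bullet> b) *\<^sub>R b) = x"
    by (intro orthonormal_basis_expand[OF orth norm]) auto
  then show ?thesis
    by (simp add: sum.reindex[OF inj] inner_commute)
qed

text \<open>
  This recognises a polar factor without displaying normalised singular vectors: it suffices that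
  \<open>M\<close> is a positive multiple of \<open>P\<close> on each member of an orthogonal basis. Normalising the basis
  to \<open>v\<close>, the vectors \<open>P v k\<close> and \<open>v k\<close> are singular vectors of \<open>M\<close>, because \<open>P\<close> is an isometry.
\<close>

lemma polar_eqI:
  fixes M P :: "real^'n^'m" and w :: "nat \<Rightarrow> real^'n"
  assumes orth: "\<And>k l. k < CARD('n) \<Longrightarrow> l < CARD('n) \<Longrightarrow> k \<noteq> l \<Longrightarrow> w k \<bullet> w l = 0"
    and nz: "\<And>k. k < CARD('n) \<Longrightarrow> w k \<noteq> 0"
    and pos: "\<And>k. k < CARD('n) \<Longrightarrow> \<sigma> k > 0"
    and act: "\<And>k. k < CARD('n) \<Longrightarrow> M *v w k = \<sigma> k *\<^sub>R (P *v w k)"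
    and iso: "transpose P ** P = mat 1"
  shows "polar M = P"
proof -
  let ?n = "CARD('n)"
  define v where "v k = w k /\<^sub>R norm (w k)" for k
  define u where "u k = P *v v k" for k
  have v: "v k \<bullet> v l = (if k = l then 1 else 0)" if "k < ?n" "l < ?n" for k l
    using orth[OF that] nz[OF that(1)]
    by (auto simp: v_def dot_square_norm power2_eq_square field_simps)
  have isoP: "(P *v x) \<bullet> (P *v y) = x \<bullet> y" for x y
    by (metis iso dot_lmul_matrix vector_transpose_matrix transpose_transpose
        matrix_vector_mul_assoc matrix_vector_mul_lid)
  have u: "u k \<bullet> u l = (if k = l then 1 else 0)" if "k < ?n" "l < ?n" for k l
    unfolding u_def isoP by (rule v[OF that])
  have Mv: "M *v v k = \<sigma> k *\<^sub>R u k" if "k < ?n" for k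
    using act[OF that] by (simp add: v_def u_def matrix_vector_mult_scaleR)
  have expand: "x = (\<Sum>k<?n. (v k \<bullet> x) *\<^sub>R v k)" for x
    by (rule orthonormal_family_expand) (rule v)
  have mult_sum: "A *v sum f {..<?n} = (\<Sum>k<?n. A *v f k)" for A :: "real^'n^'m" and f
    using linear_sum[OF matrix_vector_mul_linear, of A] .
  have M_x: "M *v x = (\<Sum>k<?n. (\<sigma> k * (v k \<bullet> x)) *\<^sub>R u k)" for x
  proof -
    have "M *v x = (\<Sum>k<?n. (v k \<bullet> x) *\<^sub>R (M *v v k))"
      by (subst expand[of x]) (simp only: mult_sum matrix_vector_mult_scaleR)
    also have "\<dots> = (\<Sum>k<?n. (\<sigma> k * (v k \<bullet> x)) *\<^sub>R u k)"
      by (rule sum.cong) (simp_all add: Mv mult.commute)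
    finally show ?thesis .
  qed
  have P_x: "P *v x = (\<Sum>k<?n. (v k \<bullet> x) *\<^sub>R u k)" for x
    by (subst expand[of x])
      (simp add: mult_sum matrix_vector_mult_scaleR u_def)
  have "M = (\<chi> i j. \<Sum>k<?n. u k $ i * \<sigma> k * v k $ j)"
    by (simp add: matrix_eq sum_outer_product_mult_vec M_x)
  moreover have rank: "rank M = ?n"
    unfolding full_rank_injective
  proof (rule linear_injective_0[THEN iffD2, OF matrix_vector_mul_linear], intro allI impI)
    fix x assume "M *v x = 0"
    have "v l \<bullet> x = 0" if l: "l < ?n" for l
    proof -
      have "0 = u l \<bullet> (M *v x)"
        using \<open>M *v x = 0\<close> by simp
      also have "\<dots> = (\<Sum>k<?n. if k = l then \<sigma> l * (v l \<bullet> x) else 0)"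
        unfolding M_x inner_sum_right by (rule sum.cong) (auto simp: u l)
      finally show ?thesis
        using pos[OF l] l by simp
    qed
    then show "x = 0"
      by (subst expand[of x]) simp
  qed
  ultimately have "thin_svd M \<sigma> u v"
    unfolding thin_svd_def using pos u v by simp
  then show ?thesis
    using sum_outer_product_mult_vec[where u = u and v = v and c = "\<lambda>_. 1"]
    by (simp add: polar_thin_svd rank matrix_eq P_x)
qed

section \<open>A sign matrix whose polar factor has an entry of the opposite sign\<close>

lemma exhaust_5: "x = 1 \<or> x = 2 \<or> x = 3 \<or> x = 4 \<or> x = (5::5)"
proof (induct x)
  case (of_int z)
  then have "z = 0 \<or> z = 1 \<or> z = 2 \<or> z = 3 \<or> z = 4" by fastforce
  then show ?case by auto
qed

lemma forall_5: "(\<forall>i::5. P i) \<longleftrightarrow> P 1 \<and> P 2 \<and> P 3 \<and> P 4 \<and> P 5"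
  by (metis exhaust_5)

lemma sum_5: "sum f (UNIV::5 set) = f 1 + f 2 + f 3 + f 4 + f 5"
proof -
  have UNIV_5: "UNIV = {1, 2, 3, 4, 5::5}" using exhaust_5 by auto
  show ?thesis unfolding UNIV_5 by (simp add: ac_simps)
qed

definition vec5 :: "real \<Rightarrow> real \<Rightarrow> real \<Rightarrow> real \<Rightarrow> real \<Rightarrow> real^5" where
  "vec5 a b c d e = (\<chi> i. if i = 1 then a else if i = 2 then b else if i = 3 then c
     else if i = 4 then d else e)"

lemma vec5_nth [simp]:
  "vec5 a b c d e $ 1 = a" "vec5 a b c d e $ 2 = b" "vec5 a b c d e $ 3 = c"
  "vec5 a b c d e $ 4 = d" "vec5 a b c d e $ 5 = e"
  by (simp_all add: vec5_def)

definition bordered :: "real \<Rightarrow> real \<Rightarrow> real \<Rightarrow> real \<Rightarrow> real^5^5" where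
  "bordered a b c d = (\<chi> i j. if i = 1 then (if j = 1 then a else b)
     else if j = 1 then b else if i = j then c else d)"

abbreviation corner_sign :: "real^5^5" where
  "corner_sign \<equiv> bordered 1 1 (-1) 1"

text \<open>
  The values on the plane described at the top give the corner, the border and the averaged part
  \<open>1 / (4 \<surd>17)\<close> of the block; the rest of the block is \<open>-1\<close> times the projection onto the vectors
  of sum zero, which has entries \<open>3/4\<close> on and \<open>-1/4\<close> off the diagonal.
\<close>

definition corner_polar :: "real^5^5" where
  "corner_polar = bordered (-1 / sqrt 17) (2 / sqrt 17)
     (1 / (4 * sqrt 17) - 3/4) (1 / (4 * sqrt 17) + 1/4)"

definition corner_gradient :: "real^5^5" where
  "corner_gradient = bordered 100 1 (-1) 1"

lemma bordered_mult_vec5: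
  "bordered a b c d *v vec5 x y1 y2 y3 y4 =
     (let s = y1 + y2 + y3 + y4; y = (\<lambda>t. b * x + d * s + (c - d) * t)
      in vec5 (a * x + b * s) (y y1) (y y2) (y y3) (y y4))"
  by (simp add: vec_eq_iff forall_5 matrix_vector_mult_def sum_5 bordered_def Let_def algebra_simps)

lemma inner_vec5:
  "vec5 a b c d e \<bullet> vec5 a' b' c' d' e' = a * a' + b * b' + c * c' + d * d' + e * e'"
  by (simp add: inner_vec_def sum_5)

lemma inner_bordered:
  "bordered a b c d \<bullet> bordered a' b' c' d' = a * a' + 8 * (b * b') + 4 * (c * c') + 12 * (d * d')"
  by (simp add: inner_vec_def sum_5 bordered_def)

lemma corner_polar_orthogonal: "transpose corner_polar ** corner_polar = mat 1"
proof -
  define x :: real where "x = 1 / sqrt 17"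
  have x: "x * x = 1 / 17" "x * (x * c) = c / 17" for c
    by (simp_all add: x_def)
  have P: "corner_polar = bordered (- x) (2 * x) (x / 4 - 3 / 4) (x / 4 + 1 / 4)"
    by (simp add: corner_polar_def x_def mult.commute)
  show ?thesis
    unfolding P by (simp add: x vec_eq_iff forall_5 matrix_matrix_mult_def transpose_def mat_def sum_5
        bordered_def algebra_simps add_divide_distrib diff_divide_distrib)
qed

lemma polar_corner_sign: "polar corner_sign = corner_polar"
proof -
  define r :: real where "r = sqrt 17"
  have r: "r * r = 17" "r > 4"
    by (simp_all add: r_def real_less_rsqrt)
  have r_assoc: "r * (r * c) = 17 * c" for c
    by (simp add: r(1) flip: mult.assoc)
  define w where "w = (!) [vec5 ((r - 1) / 2) 1 1 1 1, vec5 (- (r + 1) / 2) 1 1 1 1,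
    vec5 0 1 1 (-1) (-1), vec5 0 1 (-1) 1 (-1), vec5 0 1 (-1) (-1) 1]"
  define \<sigma> where "\<sigma> = (!) [(r + 3) / 2, (r - 3) / 2, 2, 2, 2]"
  have w: "w 0 = vec5 ((r - 1) / 2) 1 1 1 1" "w (Suc 0) = vec5 (- (r + 1) / 2) 1 1 1 1"
    "w 2 = vec5 0 1 1 (-1) (-1)" "w 3 = vec5 0 1 (-1) 1 (-1)" "w 4 = vec5 0 1 (-1) (-1) 1"
    by (simp_all add: w_def)
  have \<sigma>: "\<sigma> 0 = (r + 3) / 2" "\<sigma> (Suc 0) = (r - 3) / 2" "\<sigma> 2 = 2" "\<sigma> 3 = 2" "\<sigma> 4 = 2"
    by (simp_all add: \<sigma>_def)
  \<comment> \<open>The \<open>w k\<close> are eigenvectors of \<open>corner_sign\<close> for the eigenvalues \<open>(3 + r) / 2\<close>, \<open>(3 - r) / 2\<close>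
     and \<open>-2\<close> (three times); the \<open>\<sigma> k\<close> are the absolute values.\<close>
  have less_5: "k = 0 \<or> k = 1 \<or> k = 2 \<or> k = 3 \<or> k = 4" if "k < CARD(5)" for k :: nat
    using that by auto
  show ?thesis
  proof (rule polar_eqI[where w = w and \<sigma> = \<sigma>])
    show "w k \<bullet> w l = 0" if "k < CARD(5)" "l < CARD(5)" "k \<noteq> l" for k l
      using less_5[OF that(1)] less_5[OF that(2)] that(3)
      by (elim disjE) (simp_all add: w inner_vec5 field_simps r(1))
    show "w k \<noteq> 0" if "k < CARD(5)" for k
      using less_5[OF that] by (elim disjE) (simp_all add: w vec_eq_iff forall_5)
    show "\<sigma> k > 0" if "k < CARD(5)" for k
      using less_5[OF that] r(2) by (elim disjE) (simp_all add: \<sigma>)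
    show "corner_sign *v w k = \<sigma> k *\<^sub>R (corner_polar *v w k)" if "k < CARD(5)" for k
      using less_5[OF that] r(2)
      by (elim disjE) (simp_all add: w \<sigma> corner_polar_def bordered_mult_vec5 Let_def vec_eq_iff
          forall_5 field_simps r(1) r_assoc flip: r_def)
    show "transpose corner_polar ** corner_polar = mat 1"
      by (rule corner_polar_orthogonal)
  qed
qed

lemma inner_corner_gradient_polar: "corner_gradient \<bullet> corner_polar = 6 - 82 / sqrt 17"
  by (simp add: corner_gradient_def corner_polar_def inner_bordered field_simps)

lemma inner_corner_gradient_polar_bounds:
  "corner_gradient \<bullet> corner_polar \<in> {-13.89<..<-13.885}"
proof -
  \<comment> \<open>Rational bounds just inside \<open>82 / 19.89\<close> and \<open>82 / 19.885\<close>.\<close>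
  have upper: "sqrt 17 < 4.12366"
    by (rule real_less_lsqrt) (simp_all add: power2_eq_square)
  have lower: "4.1228 < sqrt 17"
    by (rule real_less_rsqrt) (simp add: power2_eq_square)
  have "82 / sqrt 17 < 19.89" "19.885 < 82 / sqrt 17"
    using upper lower by (simp_all add: pos_divide_less_eq pos_less_divide_eq)
  then show ?thesis
    unfolding inner_corner_gradient_polar by simp
qed

lemma is_sign_of_corner_gradient:
  assumes "c > 0" and "is_sign_of (c *\<^sub>R corner_gradient) S"
  shows "S = corner_sign"
  using assms unfolding is_sign_of_def
  by (simp add: vec_eq_iff corner_gradient_def bordered_def sgn_mult split: if_splits)

section \<open>MuonUSign on a linear objective\<close>

lemma GDERIV_inner_left_unique:
  assumes "GDERIV (\<lambda>X. G \<bullet> X) x :> D"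
  shows "D = G"
proof -
  have "((\<lambda>X. G \<bullet> X) has_derivative (\<lambda>h. h \<bullet> G)) (at x)"
    by (auto intro!: derivative_eq_intros simp: inner_commute)
  then have "(\<lambda>h. h \<bullet> D) = (\<lambda>h. h \<bullet> G)"
    using assms has_derivative_unique unfolding gderiv_def by blast
  then show ?thesis
    by (metis vector_eq_ldot)
qed

text \<open>
  Exponential averaging of a constant gradient from \<open>0\<close> gives \<open>M t = (1 - \<mu>\<^sup>t) G\<close>, and the Nesterov
  variant mixes this with \<open>G\<close> itself. Either way the factor \<open>c\<close> is positive, as \<open>t \<ge> 1\<close> and \<open>\<mu> < 1\<close>.
\<close>

lemma MuonUSign_run_linear_step:
  assumes run: "MuonUSign_run variant (\<lambda>X. G \<bullet> X) \<mu> \<eta> X0 X"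
    and \<mu>: "0 \<le> \<mu>" "\<mu> < 1" and t: "t \<ge> 1"
  obtains c S where "c > 0" "is_sign_of (c *\<^sub>R G) S" "X t = X (t - 1) - \<eta> t *\<^sub>R polar S"
proof -
  obtain D M S where M0: "M 0 = 0" and
    D: "\<And>t. t \<ge> 1 \<Longrightarrow> GDERIV (\<lambda>X. G \<bullet> X) (X (t - 1)) :> D t" and
    M: "\<And>t. t \<ge> 1 \<Longrightarrow> M t = \<mu> *\<^sub>R M (t - 1) + (1 - \<mu>) *\<^sub>R D t" and
    S: "is_sign_of (update_momentum variant \<mu> (D t) (M t)) (S t)" and
    X: "X t = X (t - 1) - \<eta> t *\<^sub>R polar (S t)"
    using run t unfolding MuonUSign_run_def by blast
  have D_eq: "D t = G" if "t \<ge> 1" for t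
    using D[OF that] by (rule GDERIV_inner_left_unique)
  have M_eq: "M t = (1 - \<mu> ^ t) *\<^sub>R G" for t
  proof (induction t)
    case (Suc t)
    have "M (Suc t) = (\<mu> * (1 - \<mu> ^ t) + (1 - \<mu>)) *\<^sub>R G"
      by (simp add: M D_eq Suc scaleR_add_left)
    then show ?case
      by (simp add: right_diff_distrib)
  qed (simp add: M0)
  have pos: "1 - \<mu> ^ t > 0"
    using \<mu> t by (simp add: power_less_one_iff)
  obtain c where "c > 0" "update_momentum variant \<mu> (D t) (M t) = c *\<^sub>R G"
  proof (cases variant)
    case Standard
    then show ?thesis
      using that[OF pos] by (simp add: M_eq)
  next
    case Nesterov
    have "1 - \<mu> + \<mu> * (1 - \<mu> ^ t) > 0"
      using \<mu> pos by (intro add_pos_nonneg) auto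
    then show ?thesis
      using that Nesterov t by (simp add: M_eq D_eq scaleR_add_left)
  qed
  then show ?thesis
    using that S X by metis
qed

lemma inner_eq_trace: "G \<bullet> X = trace (transpose G ** (X :: real^'n^'m))"
  by (simp add: inner_vec_def trace_def matrix_matrix_mult_def transpose_def) (rule sum.swap)

theorem theorem2:
  shows "\<exists>G :: real^5^5.
    (\<forall>S. is_sign_of G S \<longrightarrow>
       round (100 * (G \<bullet> polar S)) = -1389 \<and> G \<bullet> polar S < 0) \<and>
    (\<forall>X. G \<bullet> X = trace (transpose G ** X)) \<and>
    (\<forall>(X\<^sub>0 :: real^5^5) (\<eta> :: nat \<Rightarrow> real) (\<mu> :: real) (variant :: momentum) (X :: nat \<Rightarrow> real^5^5).
       (\<forall>t\<ge>1. \<eta> t > 0) \<longrightarrow> 0 \<le> \<mu> \<longrightarrow> \<mu> < 1 \<longrightarrow>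
       MuonUSign_run variant (\<lambda>X. G \<bullet> X) \<mu> \<eta> X\<^sub>0 X \<longrightarrow>
       (\<forall>t\<ge>1. G \<bullet> X t > G \<bullet> X (t - 1)))"
proof (rule exI[of _ corner_gradient], intro conjI allI impI)
  note bounds = inner_corner_gradient_polar_bounds[simplified]
  fix S assume "is_sign_of corner_gradient S"
  then have "polar S = corner_polar"
    using is_sign_of_corner_gradient[of 1 S] polar_corner_sign by simp
  then show "round (100 * (corner_gradient \<bullet> polar S)) = -1389"
    and "corner_gradient \<bullet> polar S < 0"
    using bounds by (auto intro!: round_unique)
next
  fix X show "corner_gradient \<bullet> X = trace (transpose corner_gradient ** X)"
    by (rule inner_eq_trace)
next
  fix X\<^sub>0 :: "real^5^5" and \<eta> :: "nat \<Rightarrow> real" and \<mu> :: real and variant :: momentum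
    and X :: "nat \<Rightarrow> real^5^5" and t :: nat
  assume \<eta>: "\<forall>t\<ge>1. \<eta> t > 0" and \<mu>: "0 \<le> \<mu>" "\<mu> < 1" and t: "1 \<le> t"
    and run: "MuonUSign_run variant (\<lambda>X. corner_gradient \<bullet> X) \<mu> \<eta> X\<^sub>0 X"
  obtain c S where "c > 0" "is_sign_of (c *\<^sub>R corner_gradient) S"
    and X: "X t = X (t - 1) - \<eta> t *\<^sub>R polar S"
    using MuonUSign_run_linear_step[OF run \<mu> t] .
  then have "polar S = corner_polar"
    using is_sign_of_corner_gradient polar_corner_sign by simp
  moreover have "\<eta> t * (corner_gradient \<bullet> corner_polar) < 0"
    using \<eta> t inner_corner_gradient_polar_bounds by (simp add: mult_pos_neg)
  ultimately show "corner_gradient \<bullet> X (t - 1) < corner_gradient \<bullet> X t"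
    by (simp add: X inner_diff_right)
qed

end
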